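(* Let $n\ge3$. Let $(X,g)$ be an $n$-dimensional smooth connected Riemannian manifold without boundary, and let $Y_1,Y_2\subset X$ be $n$-dimensional compact connected $C^0$-submanifolds with nonempty boundaries $\partial Y_1$ and $\partial Y_2$, each satisfying conditions (i), (ii) and (iii). Assume that $Y_1$ is strictly convex in the metric $\rho_{Y_1}$. Assume that $X$ has the additional property that $\rho_X(x,y)=\rho_Y(x,y)$ for any two points $x,y$ in every $n$-dimensional compact connected $C^0$-submanifold $Y\subset X$ with $\partial Y\ne\varnothing$ satisfying conditions (i)–(iii) and strictly convex with respect to $\rho_Y$. Assume also that $\partial Y_1$ and $\partial Y_2$ are isometric with respect to the metrics $\rho_{Y_j}$, $j=1,2$. Then $\partial Y_1$ and $\partial Y_2$ are isometric with respect to $\rho_X$.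
   Context: $\rho_X(x,y)$ is the intrinsic metric of $X$: the infimum of the Riemannian lengths of smooth paths in $X$ joining $x$ and $y$. An $n$-dimensional $C^0$-submanifold $Y$ with boundary of an $n$-dimensional manifold $X$ is a subset which is an $n$-dimensional topological manifold with boundary in the induced topology; $\partial Y$ is its boundary and $\mathrm{Int}\,Y=Y\setminus\partial Y$ its interior. Conditions on $Y$: (i) for all $x,y\in Y$, $$\rho_Y(x,y)=\liminf_{x'\to x,\;y'\to y;\;x',y'\in\mathrm{Int}\,Y}\{\inf[l(\gamma_{x',y',\mathrm{Int}\,Y})]\}<\infty,$$ where the infimum is over the Riemannian lengths of smooth paths $\gamma_{x',y',\mathrm{Int}\,Y}:[0,1]\to\mathrm{Int}\,Y$ joining $x'$ and $y'$ in $\mathrm{Int}\,Y$ (this formula also defines $\rho_Y$); (ii) $\rho_Y$ is a metric on $Y$; (iii) for any two points $a,b\in Y$ there exist points $c,d\in\partial Y$ which can be joined in $Y$ by a shortest path $\gamma:[0,1]\to Y$ in the metric $\rho_Y$ so that $a,b\in\gamma([0,1])$. A shortest path in the metric $\rho_Y$ between distinct points $\alpha,\beta\in Y$ is a path $\gamma:[0,1]\to Y$ with $\gamma(0)=\alpha$, $\gamma(1)=\beta$ and $\rho_Y(\gamma(s),\gamma(t))=(t-s)\rho_Y(\alpha,\beta)$ for $0\le s<t\le1$. Paths are continuous and non-constant. $Y$ is strictly convex in the metric $\rho_Y$ if for any $\alpha,\beta\in Y$ every shortest path $\gamma:[0,1]\to Y$ between $\alpha$ and $\beta$ in the metric $\rho_Y$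 satisfies $\gamma(]0,1[)\subset\mathrm{Int}\,Y$. $\partial Y_1$ and $\partial Y_2$ are isometric in the metrics $\rho_{Y_j}$ if there is a surjective map $f:\partial Y_1\to\partial Y_2$ with $\rho_{Y_2}(f(x),f(y))=\rho_{Y_1}(x,y)$ for all $x,y\in\partial Y_1$; they are isometric with respect to $\rho_X$ if there is a surjective map $f:\partial Y_1\to\partial Y_2$ with $\rho_X(f(x),f(y))=\rho_X(x,y)$ for all $x,y\in\partial Y_1$. *)

theory Defs
  imports "HOL-Analysis.Analysis"
begin

section \<open>Smooth maps\<close>

(* Class C^k on an open set U of a finite-dimensional space: f is differentiable and all its
   directional derivatives are C^(k-1), which is the same as Df being C^(k-1). *)
primrec Ck_on :: "nat \<Rightarrow> ('a::real_normed_vector \<Rightarrow> 'b::real_normed_vector) \<Rightarrow> 'a set \<Rightarrow> bool" where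
  "Ck_on 0 f U \<longleftrightarrow> continuous_on U f"
| "Ck_on (Suc k) f U \<longleftrightarrow>
     (\<forall>x\<in>U. f differentiable (at x)) \<and> (\<forall>v. Ck_on k (\<lambda>x. frechet_derivative f (at x) v) U)"

(* C^infinity on an arbitrary set S: locally the restriction of a C^infinity map on an open set.
   For open S this is ordinary smoothness; for S an interval it includes one-sided smoothness at
   the end points. *)
definition smooth_on :: "'a::real_normed_vector set \<Rightarrow> ('a \<Rightarrow> 'b::real_normed_vector) \<Rightarrow> bool" where
  "smooth_on S f \<longleftrightarrow>
     (\<forall>x\<in>S. \<exists>U h. open U \<and> x \<in> U \<and> (\<forall>k. Ck_on k h U) \<and> (\<forall>y\<in>S \<inter> U. h y = f y))"

section \<open>Riemannian manifolds\<close>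

(* A chart is a pair (U, phi) of its domain and its coordinate map. *)
type_synonym ('a, 'n) chart = "'a set \<times> ('a \<Rightarrow> real ^ 'n)"

(* The dimension is CARD('n).  For a chart c and a point p of its domain, "rmetric M c p v w" is
   g_p(v, w) for tangent vectors given by their components v, w in the chart c. *)
record ('a, 'n) riemannian =
  rtop :: "'a topology"
  atlas :: "('a, 'n) chart set"
  rmetric :: "('a, 'n) chart \<Rightarrow> 'a \<Rightarrow> real ^ 'n \<Rightarrow> real ^ 'n \<Rightarrow> real"

definition transition :: "('a, 'n::finite) chart \<Rightarrow> ('a, 'n) chart \<Rightarrow> real ^ 'n \<Rightarrow> real ^ 'n" where
  "transition c d = snd d \<circ> inv_into (fst c) (snd c)"

definition smooth_manifold :: "('a, 'n::finite) riemannian \<Rightarrow> bool" where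
  "smooth_manifold M \<longleftrightarrow>
     Hausdorff_space (rtop M) \<and> second_countable (rtop M) \<and>
     (\<Union>c\<in>atlas M. fst c) = topspace (rtop M) \<and>
     (\<forall>(U, \<phi>)\<in>atlas M. openin (rtop M) U \<and> open (\<phi> ` U) \<and>
        homeomorphic_map (subtopology (rtop M) U) (top_of_set (\<phi> ` U)) \<phi>) \<and>
     (\<forall>c\<in>atlas M. \<forall>d\<in>atlas M. smooth_on (snd c ` (fst c \<inter> fst d)) (transition c d))"

definition smooth_riemannian_metric :: "('a, 'n::finite) riemannian \<Rightarrow> bool" where
  "smooth_riemannian_metric M \<longleftrightarrow>
     (\<forall>c\<in>atlas M. \<forall>p\<in>fst c.
        bilinear (rmetric M c p) \<and>
        (\<forall>v w. rmetric M c p v w = rmetric M c p w v) \<and>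
        (\<forall>v. v \<noteq> 0 \<longrightarrow> rmetric M c p v v > 0)) \<and>
     (\<forall>c\<in>atlas M. \<forall>v w.
        smooth_on (snd c ` fst c) (\<lambda>x. rmetric M c (inv_into (fst c) (snd c) x) v w)) \<and>
     (\<forall>c\<in>atlas M. \<forall>d\<in>atlas M. \<forall>p\<in>fst c \<inter> fst d. \<forall>v w.
        rmetric M c p v w =
        rmetric M d p (frechet_derivative (transition c d) (at (snd c p)) v)
                      (frechet_derivative (transition c d) (at (snd c p)) w))"

definition riemannian_manifold :: "('a, 'n::finite) riemannian \<Rightarrow> bool" where
  "riemannian_manifold M \<longleftrightarrow> smooth_manifold M \<and> smooth_riemannian_metric M"

section \<open>Lengths and intrinsic metrics\<close>

definition smooth_path_in :: "('a, 'n::finite) riemannian \<Rightarrow> 'a set \<Rightarrow> (real \<Rightarrow> 'a) \<Rightarrow> bool" where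
  "smooth_path_in M S \<gamma> \<longleftrightarrow>
     pathin (subtopology (rtop M) S) \<gamma> \<and> \<not> \<gamma> constant_on {0..1} \<and>
     (\<forall>(U, \<phi>)\<in>atlas M. smooth_on {t \<in> {0..1}. \<gamma> t \<in> U} (\<phi> \<circ> \<gamma>))"

(* The norm of the velocity vector, computed in some chart at the point; by the transformation law
   of the metric it does not depend on the chart. *)
definition speed :: "('a, 'n::finite) riemannian \<Rightarrow> (real \<Rightarrow> 'a) \<Rightarrow> real \<Rightarrow> real" where
  "speed M \<gamma> t =
     (let c = (SOME c. c \<in> atlas M \<and> \<gamma> t \<in> fst c);
          v = vector_derivative (snd c \<circ> \<gamma>) (at t within {0..1})
      in sqrt (rmetric M c (\<gamma> t) v v))"

definition riemannian_length :: "('a, 'n::finite) riemannian \<Rightarrow> (real \<Rightarrow> 'a) \<Rightarrow> real" where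
  "riemannian_length M \<gamma> = integral {0..1} (speed M \<gamma>)"

(* Extended-real valued: the infimum is infinite when no smooth path in S joins x and y. *)
definition inf_length :: "('a, 'n::finite) riemannian \<Rightarrow> 'a set \<Rightarrow> 'a \<Rightarrow> 'a \<Rightarrow> ennreal" where
  "inf_length M S x y =
     (INF \<gamma>\<in>{\<gamma>. smooth_path_in M S \<gamma> \<and> \<gamma> 0 = x \<and> \<gamma> 1 = y}. ennreal (riemannian_length M \<gamma>))"

(* Always finite when M is connected. *)
definition rho_X :: "('a, 'n::finite) riemannian \<Rightarrow> 'a \<Rightarrow> 'a \<Rightarrow> real" where
  "rho_X M x y = enn2real (inf_length M (topspace (rtop M)) x y)"

section \<open>Submanifolds with boundary\<close>

(* A homeomorphism from an open subset U of T onto a relatively open subset of a coordinate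
   half-space of R^n. *)
definition half_space_chart ::
  "'a topology \<Rightarrow> 'a set \<Rightarrow> ('a \<Rightarrow> real ^ 'n::finite) \<Rightarrow> 'n \<Rightarrow> bool" where
  "half_space_chart T U \<phi> k \<longleftrightarrow>
     openin T U \<and> openin (top_of_set {x. 0 \<le> x $ k}) (\<phi> ` U) \<and>
     homeomorphic_map (subtopology T U) (top_of_set (\<phi> ` U)) \<phi>"

(* "M" fixes the ambient manifold and, through its type, the dimension CARD('n) of Y. *)
definition C0_submanifold :: "('a, 'n::finite) riemannian \<Rightarrow> 'a set \<Rightarrow> bool" where
  "C0_submanifold M Y \<longleftrightarrow>
     Y \<subseteq> topspace (rtop M) \<and>
     Hausdorff_space (subtopology (rtop M) Y) \<and> second_countable (subtopology (rtop M) Y) \<and>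
     (\<forall>p\<in>Y. \<exists>U (\<phi> :: 'a \<Rightarrow> real ^ 'n) k.
        p \<in> U \<and> half_space_chart (subtopology (rtop M) Y) U \<phi> k)"

(* The manifold boundary: points sent by some half-space chart into the bounding hyperplane. *)
definition bdry :: "('a, 'n::finite) riemannian \<Rightarrow> 'a set \<Rightarrow> 'a set" where
  "bdry M Y = {p \<in> Y. \<exists>U (\<phi> :: 'a \<Rightarrow> real ^ 'n) k.
     p \<in> U \<and> half_space_chart (subtopology (rtop M) Y) U \<phi> k \<and> \<phi> p $ k = 0}"

definition interior_pts :: "('a, 'n::finite) riemannian \<Rightarrow> 'a set \<Rightarrow> 'a set" where
  "interior_pts M Y = Y - bdry M Y"

section \<open>The metric of a submanifold\<close>

(* The lower limit is over (x', y') -> (x, y) within Int Y x Int Y; the pair (x, y) itself is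
   admitted when both points lie in Int Y. *)
definition rho_ext :: "('a, 'n::finite) riemannian \<Rightarrow> 'a set \<Rightarrow> 'a \<Rightarrow> 'a \<Rightarrow> ennreal" where
  "rho_ext M Y x y =
     Liminf (inf (nhdsin (rtop M) x \<times>\<^sub>F nhdsin (rtop M) y) (principal (interior_pts M Y \<times> interior_pts M Y)))
       (\<lambda>(x', y'). inf_length M (interior_pts M Y) x' y')"

definition rho :: "('a, 'n::finite) riemannian \<Rightarrow> 'a set \<Rightarrow> 'a \<Rightarrow> 'a \<Rightarrow> real" where
  "rho M Y x y = enn2real (rho_ext M Y x y)"

definition shortest_path ::
  "('a, 'n::finite) riemannian \<Rightarrow> 'a set \<Rightarrow> 'a \<Rightarrow> 'a \<Rightarrow> (real \<Rightarrow> 'a) \<Rightarrow> bool" where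
  "shortest_path M Y \<alpha> \<beta> \<gamma> \<longleftrightarrow>
     \<alpha> \<in> Y \<and> \<beta> \<in> Y \<and> \<alpha> \<noteq> \<beta> \<and>
     pathin (subtopology (rtop M) Y) \<gamma> \<and> \<gamma> 0 = \<alpha> \<and> \<gamma> 1 = \<beta> \<and>
     (\<forall>s t. 0 \<le> s \<and> s < t \<and> t \<le> 1 \<longrightarrow> rho M Y (\<gamma> s) (\<gamma> t) = (t - s) * rho M Y \<alpha> \<beta>)"

definition cond_i :: "('a, 'n::finite) riemannian \<Rightarrow> 'a set \<Rightarrow> bool" where
  "cond_i M Y \<longleftrightarrow> (\<forall>x\<in>Y. \<forall>y\<in>Y. rho_ext M Y x y < \<infinity>)"

(* Metric_space asks for non-negativity and symmetry at all points of the type, not only on Y;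
   this is harmless, as on a Riemannian manifold rho is non-negative and symmetric everywhere
   (paths can be reversed). *)
definition cond_ii :: "('a, 'n::finite) riemannian \<Rightarrow> 'a set \<Rightarrow> bool" where
  "cond_ii M Y \<longleftrightarrow> Metric_space Y (rho M Y)"

definition cond_iii :: "('a, 'n::finite) riemannian \<Rightarrow> 'a set \<Rightarrow> bool" where
  "cond_iii M Y \<longleftrightarrow>
     (\<forall>a\<in>Y. \<forall>b\<in>Y. \<exists>c\<in>bdry M Y. \<exists>d\<in>bdry M Y. \<exists>\<gamma>.
        shortest_path M Y c d \<gamma> \<and> a \<in> \<gamma> ` {0..1} \<and> b \<in> \<gamma> ` {0..1})"

definition admissible :: "('a, 'n::finite) riemannian \<Rightarrow> 'a set \<Rightarrow> bool" where
  "admissible M Y \<longleftrightarrow>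
     C0_submanifold M Y \<and> compactin (rtop M) Y \<and> connectedin (rtop M) Y \<and> bdry M Y \<noteq> {} \<and>
     cond_i M Y \<and> cond_ii M Y \<and> cond_iii M Y"

definition strictly_convex :: "('a, 'n::finite) riemannian \<Rightarrow> 'a set \<Rightarrow> bool" where
  "strictly_convex M Y \<longleftrightarrow>
     (\<forall>\<alpha>\<in>Y. \<forall>\<beta>\<in>Y. \<forall>\<gamma>. shortest_path M Y \<alpha> \<beta> \<gamma> \<longrightarrow> \<gamma> ` {0<..<1} \<subseteq> interior_pts M Y)"

definition isometric_sets ::
  "'a set \<Rightarrow> ('a \<Rightarrow> 'a \<Rightarrow> real) \<Rightarrow> 'a set \<Rightarrow> ('a \<Rightarrow> 'a \<Rightarrow> real) \<Rightarrow> bool" where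
  "isometric_sets A d\<^sub>A B d\<^sub>B \<longleftrightarrow>
     (\<exists>f. f ` A = B \<and> (\<forall>x\<in>A. \<forall>y\<in>A. d\<^sub>B (f x) (f y) = d\<^sub>A x y))"

end

theory Submission
  imports Defs
begin

text \<open>
  On the boundary of a strictly convex admissible submanifold the two metrics \<open>rho_X M\<close> and
  \<open>rho M Y\<close> agree by hypothesis, so an isometry for the metrics \<open>rho M Y\<^sub>j\<close> is an isometry for
  \<open>rho_X M\<close> as soon as \<open>Y\<^sub>2\<close>, too, is strictly convex.  The point is that strict convexity can be
  read off from the metric \<open>rho M Y\<close> restricted to the boundary: an admissible \<open>Y\<close> is strictly
  convex iff no boundary point \<open>e\<close> lies strictly between two other boundary points \<open>c\<close>, \<open>d\<close>, that
  is, satisfies \<open>rho c e + rho e d = rho c d\<close>.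

  If some shortest path of \<open>Y\<close> from \<open>\<alpha>\<close> to \<open>\<beta>\<close> touches the boundary in between at \<open>e\<close>, condition
  (iii) places \<open>\<alpha>\<close> and \<open>\<beta>\<close> on a shortest path with boundary end points \<open>c\<close>, \<open>d\<close>, and \<open>e\<close> lies
  strictly between \<open>c\<close> and \<open>d\<close> (lemma \<open>boundary_betweenness_if_not_strictly_convex\<close>).
  Conversely, if \<open>e\<close> lies strictly between \<open>c\<close> and \<open>d\<close>, condition (iii) provides shortest paths
  from \<open>c\<close> to \<open>e\<close> and from \<open>e\<close> to \<open>d\<close>, whose concatenation is a shortest path that passes through
  the boundary point \<open>e\<close> (lemma \<open>no_boundary_betweenness_if_strictly_convex\<close>).
\<close>

section \<open>Shortest paths\<close>

text \<open>
  The lower bounds follow from the upper ones: a shortcut between \<open>\<gamma> s\<close> and \<open>\<gamma> t\<close> would, by the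
  triangle inequality, bring \<open>\<alpha>\<close> and \<open>\<beta>\<close> closer together than they are.
\<close>

lemma shortest_pathI_upper_bound:
  assumes "Metric_space Y (rho M Y)"
    and "\<alpha> \<in> Y" "\<beta> \<in> Y" "\<alpha> \<noteq> \<beta>"
    and path: "pathin (subtopology (rtop M) Y) \<gamma>" and ends: "\<gamma> 0 = \<alpha>" "\<gamma> 1 = \<beta>"
    and upper: "\<And>s t. 0 \<le> s \<Longrightarrow> s \<le> t \<Longrightarrow> t \<le> 1 \<Longrightarrow>
      rho M Y (\<gamma> s) (\<gamma> t) \<le> (t - s) * rho M Y \<alpha> \<beta>"
  shows "shortest_path M Y \<alpha> \<beta> \<gamma>"
proof -
  interpret Metric_space Y "rho M Y" by fact
  have in_Y: "\<gamma> t \<in> Y" if "0 \<le> t" "t \<le> 1" for t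
    using path that by (auto simp: pathin_def continuous_map_in_subtopology)
  have "rho M Y (\<gamma> s) (\<gamma> t) = (t - s) * rho M Y \<alpha> \<beta>" if st: "0 \<le> s" "s < t" "t \<le> 1" for s t
  proof (rule antisym)
    show "rho M Y (\<gamma> s) (\<gamma> t) \<le> (t - s) * rho M Y \<alpha> \<beta>"
      using upper st by simp
    have "rho M Y \<alpha> \<beta> \<le> rho M Y \<alpha> (\<gamma> s) + rho M Y (\<gamma> s) (\<gamma> t) + rho M Y (\<gamma> t) \<beta>"
      using triangle[of \<alpha> "\<gamma> s" \<beta>] triangle[of "\<gamma> s" "\<gamma> t" \<beta>] in_Y[of s] in_Y[of t] st assms(2,3)
      by simp
    moreover have "rho M Y \<alpha> (\<gamma> s) \<le> s * rho M Y \<alpha> \<beta>" "rho M Y (\<gamma> t) \<beta> \<le> (1 - t) * rho M Y \<alpha> \<beta>"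
      using upper[of 0 s] upper[of t 1] st ends by auto
    ultimately show "(t - s) * rho M Y \<alpha> \<beta> \<le> rho M Y (\<gamma> s) (\<gamma> t)"
      by (simp add: algebra_simps)
  qed
  then show ?thesis
    using assms unfolding shortest_path_def by blast
qed

lemma shortest_path_in:
  assumes "shortest_path M Y \<alpha> \<beta> \<gamma>" "0 \<le> t" "t \<le> 1"
  shows "\<gamma> t \<in> Y"
  using assms by (auto simp: shortest_path_def pathin_def continuous_map_in_subtopology)

lemma shortest_path_dist:
  assumes "Metric_space Y (rho M Y)" "shortest_path M Y \<alpha> \<beta> \<gamma>"
    and "0 \<le> s" "s \<le> 1" "0 \<le> t" "t \<le> 1"
  shows "rho M Y (\<gamma> s) (\<gamma> t) = \<bar>t - s\<bar> * rho M Y \<alpha> \<beta>"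
proof -
  interpret Metric_space Y "rho M Y" by fact
  have ordered: "rho M Y (\<gamma> s) (\<gamma> t) = (t - s) * rho M Y \<alpha> \<beta>"
    if "0 \<le> s" "s < t" "t \<le> 1" for s t
    using assms(2) that unfolding shortest_path_def by blast
  consider "s < t" | "s = t" | "t < s" by linarith
  then show ?thesis
  proof cases
    case 1 then show ?thesis using ordered[of s t] assms by simp
  next
    case 2 then show ?thesis using shortest_path_in[OF assms(2,3,4)] by simp
  next
    case 3 then show ?thesis using ordered[of t s] commute[of "\<gamma> s" "\<gamma> t"] assms by simp
  qed
qed

lemma shortest_path_restrict:
  assumes metric: "Metric_space Y (rho M Y)" and \<gamma>: "shortest_path M Y \<alpha> \<beta> \<gamma>"
    and u: "0 \<le> u" "u \<le> 1" and v: "0 \<le> v" "v \<le> 1" and "u \<noteq> v"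
  shows "shortest_path M Y (\<gamma> u) (\<gamma> v) (\<lambda>t. \<gamma> ((1 - t) * u + t * v))"
proof (rule shortest_pathI_upper_bound[OF metric])
  interpret Metric_space Y "rho M Y" by (fact metric)
  have pos: "0 < rho M Y \<alpha> \<beta>" and path: "pathin (subtopology (rtop M) Y) \<gamma>"
    using \<gamma> by (auto simp: shortest_path_def intro: mdist_pos_less)
  have param: "(1 - t) * u + t * v \<in> {0..1}" if "0 \<le> t" "t \<le> 1" for t
    using that u v convex_bound_le[of u 1 v "1 - t" t] by simp
  show "\<gamma> u \<in> Y" "\<gamma> v \<in> Y"
    using shortest_path_in[OF \<gamma>] u v by auto
  show "\<gamma> u \<noteq> \<gamma> v"
    using shortest_path_dist[OF metric \<gamma> u v] \<open>u \<noteq> v\<close> pos \<open>\<gamma> u \<in> Y\<close> by auto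
  have "continuous_map (top_of_set {0..1}) (top_of_set {0..1}) (\<lambda>t. (1 - t) * u + t * v)"
    using param by (auto intro!: continuous_intros)
  from continuous_map_compose[OF this path[unfolded pathin_def]]
  show "pathin (subtopology (rtop M) Y) (\<lambda>t. \<gamma> ((1 - t) * u + t * v))"
    by (simp add: pathin_def o_def)
  fix s t :: real assume st: "0 \<le> s" "s \<le> t" "t \<le> 1"
  have "\<bar>((1 - t) * u + t * v) - ((1 - s) * u + s * v)\<bar> = \<bar>(t - s) * (v - u)\<bar>"
    by (simp add: algebra_simps)
  then have "\<bar>((1 - t) * u + t * v) - ((1 - s) * u + s * v)\<bar> = (t - s) * \<bar>v - u\<bar>"
    using st by (simp add: abs_mult)
  then show "rho M Y (\<gamma> ((1 - s) * u + s * v)) (\<gamma> ((1 - t) * u + t * v))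
      \<le> (t - s) * rho M Y (\<gamma> u) (\<gamma> v)"
    using shortest_path_dist[OF metric \<gamma>] param[of s] param[of t] st u v by simp
qed simp_all

text \<open>
  Condition (iii) makes \<open>rho M Y\<close> a geodesic metric: any two points lie on a common shortest path,
  which is cut down, and reversed if it meets them in the wrong order.
\<close>

lemma shortest_path_exists:
  assumes "Metric_space Y (rho M Y)" "cond_iii M Y" "a \<in> Y" "b \<in> Y" "a \<noteq> b"
  obtains \<gamma> where "shortest_path M Y a b \<gamma>"
proof -
  obtain c d \<gamma> where \<gamma>: "shortest_path M Y c d \<gamma>" and "a \<in> \<gamma> ` {0..1}" "b \<in> \<gamma> ` {0..1}"
    using assms unfolding cond_iii_def by blast
  then obtain u v where "u \<in> {0..1}" "v \<in> {0..1}" "a = \<gamma> u" "b = \<gamma> v"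
    by auto
  then show thesis
    using that shortest_path_restrict[OF assms(1) \<gamma>, of u v] \<open>a \<noteq> b\<close> by auto
qed

text \<open>
  Both paths run at constant speed, so the concatenation has constant speed only if it switches at
  the parameter that divides \<open>[0, 1]\<close> in the ratio of the two distances.
\<close>

lemma shortest_path_concat:
  assumes metric: "Metric_space Y (rho M Y)"
    and \<gamma>: "shortest_path M Y a e \<gamma>" and \<delta>: "shortest_path M Y e b \<delta>"
    and between: "rho M Y a e + rho M Y e b = rho M Y a b"
  obtains \<eta> r where "shortest_path M Y a b \<eta>" "0 < r" "r < 1" "\<eta> r = e"
proof -
  interpret Metric_space Y "rho M Y" by (fact metric)
  have in_Y: "a \<in> Y" "e \<in> Y" "b \<in> Y"
    and ends: "\<gamma> 0 = a" "\<gamma> 1 = e" "\<delta> 0 = e" "\<delta> 1 = b"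
    using \<gamma> \<delta> by (auto simp: shortest_path_def)
  have pos: "0 < rho M Y a e" "0 < rho M Y e b"
    using \<gamma> \<delta> by (auto simp: shortest_path_def intro: mdist_pos_less)
  define L where "L = rho M Y a b"
  define r where "r = rho M Y a e / L"
  define \<eta> where "\<eta> = (\<lambda>t. if t \<le> r then \<gamma> (t / r) else \<delta> ((t - r) / (1 - r)))"
  have "0 < L" using pos between by (simp add: L_def)
  have "rho M Y a e = r * L"
    using \<open>0 < L\<close> by (simp add: r_def)
  moreover have "rho M Y e b = L - rho M Y a e"
    using between by (simp add: L_def)
  ultimately have rL: "rho M Y a e = r * L" "rho M Y e b = (1 - r) * L"
    by (simp_all add: algebra_simps)
  have r: "0 < r" "r < 1"
    using pos \<open>0 < L\<close> rL by (simp_all add: zero_less_mult_iff)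
  have "\<eta> r = e" using r ends by (simp add: \<eta>_def)
  have first: "0 \<le> t / r" "t / r \<le> 1" if "0 \<le> t" "t \<le> r" for t
    using that r by (auto simp: field_simps)
  have second: "0 \<le> (t - r) / (1 - r)" "(t - r) / (1 - r) \<le> 1" if "r \<le> t" "t \<le> 1" for t
    using that r by (auto simp: field_simps)
  have \<eta>2: "\<eta> t = \<delta> ((t - r) / (1 - r))" if "r \<le> t" for t
    using that r ends by (cases "t = r") (auto simp: \<eta>_def)
  have dist1: "rho M Y (\<eta> s) (\<eta> t) = (t - s) * L" if "0 \<le> s" "s \<le> t" "t \<le> r" for s t
  proof -
    have "rho M Y (\<eta> s) (\<eta> t) = \<bar>t / r - s / r\<bar> * (r * L)"
      using shortest_path_dist[OF metric \<gamma>, of "s / r" "t / r"] first[of s] first[of t] that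
      by (simp add: \<eta>_def rL)
    also have "\<bar>t / r - s / r\<bar> = (t - s) / r"
      using that r by (simp flip: diff_divide_distrib)
    finally show ?thesis using r by simp
  qed
  have dist2: "rho M Y (\<eta> s) (\<eta> t) = (t - s) * L" if "r \<le> s" "s \<le> t" "t \<le> 1" for s t
  proof -
    have "rho M Y (\<eta> s) (\<eta> t) = \<bar>(t - r) / (1 - r) - (s - r) / (1 - r)\<bar> * ((1 - r) * L)"
      using shortest_path_dist[OF metric \<delta>, of "(s - r) / (1 - r)" "(t - r) / (1 - r)"]
        second[of s] second[of t] that
      by (simp add: \<eta>2 rL)
    also have "\<bar>(t - r) / (1 - r) - (s - r) / (1 - r)\<bar> = (t - s) / (1 - r)"
      using that r by (simp flip: diff_divide_distrib)
    finally show ?thesis using r by simp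
  qed
  have \<eta>_in: "\<eta> t \<in> Y" if "0 \<le> t" "t \<le> 1" for t
    using shortest_path_in[OF \<gamma>, of "t / r"] shortest_path_in[OF \<delta>, of "(t - r) / (1 - r)"]
      first[of t] second[of t] that by (auto simp: \<eta>_def)
  let ?T = "subtopology (rtop M) Y"
  have "continuous_map (top_of_set {0..1}) ?T
      (\<lambda>t. if t \<le> r then \<gamma> (t / r) else \<delta> ((t - r) / (1 - r)))"
  proof (rule continuous_map_cases_le)
    have "continuous_map (top_of_set {0..r}) (top_of_set {0..1}) (\<lambda>t. t / r)"
      using first r by (auto intro!: continuous_intros)
    moreover have "continuous_map (top_of_set {0..1}) ?T \<gamma>"
      using \<gamma> by (simp add: shortest_path_def pathin_def)
    ultimately have "continuous_map (top_of_set {0..r}) ?T (\<lambda>t. \<gamma> (t / r))"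
      by (rule continuous_map_compose[unfolded o_def])
    moreover have "{t \<in> {0..1}. t \<le> r} = {0..r}" using r by auto
    ultimately show "continuous_map
        (subtopology (top_of_set {0..1}) {t \<in> topspace (top_of_set {0..1}). t \<le> r}) ?T
        (\<lambda>t. \<gamma> (t / r))"
      using r by (simp add: subtopology_subtopology Int_absorb1)
  next
    have "continuous_map (top_of_set {r..1}) (top_of_set {0..1}) (\<lambda>t. (t - r) / (1 - r))"
      using second r by (auto intro!: continuous_intros)
    moreover have "continuous_map (top_of_set {0..1}) ?T \<delta>"
      using \<delta> by (simp add: shortest_path_def pathin_def)
    ultimately have "continuous_map (top_of_set {r..1}) ?T (\<lambda>t. \<delta> ((t - r) / (1 - r)))"
      by (rule continuous_map_compose[unfolded o_def])
    moreover have "{t \<in> {0..1}. r \<le> t} = {r..1}" using r by auto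
    ultimately show "continuous_map
        (subtopology (top_of_set {0..1}) {t \<in> topspace (top_of_set {0..1}). r \<le> t}) ?T
        (\<lambda>t. \<delta> ((t - r) / (1 - r)))"
      using r by (simp add: subtopology_subtopology Int_absorb1)
  next
    show "\<gamma> (t / r) = \<delta> ((t - r) / (1 - r))" if "t = r" for t
      using that r ends by simp
  qed (auto intro!: continuous_intros)
  then have path: "pathin ?T \<eta>"
    by (simp add: pathin_def \<eta>_def)
  have "shortest_path M Y a b \<eta>"
  proof (rule shortest_pathI_upper_bound[OF metric])
    show "a \<noteq> b" using \<open>0 < L\<close> in_Y by (auto simp: L_def)
    show "\<eta> 0 = a" "\<eta> 1 = b" using r ends by (simp_all add: \<eta>_def)
    fix s t :: real assume st: "0 \<le> s" "s \<le> t" "t \<le> 1"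
    consider "t \<le> r" | "r \<le> s" | "s \<le> r" "r \<le> t" by linarith
    then show "rho M Y (\<eta> s) (\<eta> t) \<le> (t - s) * rho M Y a b"
    proof cases
      case 3
      have "rho M Y (\<eta> s) (\<eta> t) \<le> rho M Y (\<eta> s) (\<eta> r) + rho M Y (\<eta> r) (\<eta> t)"
        using triangle \<eta>_in[of s] \<eta>_in[of r] \<eta>_in[of t] st r by simp
      also have "\<dots> = (t - s) * L"
        using dist1[of s r] dist2[of r t] st 3 by (simp add: algebra_simps)
      finally show ?thesis by (simp add: L_def)
    qed (use dist1[of s t] dist2[of s t] st in \<open>auto simp: L_def\<close>)
  qed (use in_Y path in auto)
  then show thesis using that r \<open>\<eta> r = e\<close> by blast
qed

section \<open>Strict convexity and betweenness on the boundary\<close>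

lemma no_boundary_betweenness_if_strictly_convex:
  assumes metric: "Metric_space Y (rho M Y)" and iii: "cond_iii M Y" and "strictly_convex M Y"
    and "c \<in> Y" "d \<in> Y" and e: "e \<in> bdry M Y" and "c \<noteq> e" "e \<noteq> d"
  shows "rho M Y c e + rho M Y e d \<noteq> rho M Y c d"
proof
  assume between: "rho M Y c e + rho M Y e d = rho M Y c d"
  have "e \<in> Y" using e by (simp add: bdry_def)
  obtain \<gamma> \<delta> where "shortest_path M Y c e \<gamma>" "shortest_path M Y e d \<delta>"
    using shortest_path_exists[OF metric iii] assms \<open>e \<in> Y\<close> by metis
  then obtain \<eta> r where "shortest_path M Y c d \<eta>" "0 < r" "r < 1" "\<eta> r = e"
    using shortest_path_concat[OF metric _ _ between] by blast
  then have "e \<in> interior_pts M Y"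
    using assms unfolding strictly_convex_def by fastforce
  then show False using e by (simp add: interior_pts_def)
qed

text \<open>
  Replacing the part between \<open>\<alpha>\<close> and \<open>\<beta>\<close> of the shortest path given by condition (iii) by the one
  that touches the boundary does not change the length; all that is used of this modified path is
  that the sum of the distances along it bounds the distances of its points.
\<close>

lemma boundary_betweenness_if_not_strictly_convex:
  assumes metric: "Metric_space Y (rho M Y)" and iii: "cond_iii M Y"
    and not_convex: "\<not> strictly_convex M Y"
  obtains c d e where "c \<in> bdry M Y" "d \<in> bdry M Y" "e \<in> bdry M Y" "c \<noteq> e" "e \<noteq> d"
    "rho M Y c e + rho M Y e d = rho M Y c d"
proof -
  interpret Metric_space Y "rho M Y" by (fact metric)
  obtain \<alpha> \<beta> \<gamma> where \<gamma>: "shortest_path M Y \<alpha> \<beta> \<gamma>"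
    and "\<not> \<gamma> ` {0<..<1} \<subseteq> interior_pts M Y"
    using not_convex unfolding strictly_convex_def by blast
  then obtain s where s: "0 < s" "s < 1" and "\<gamma> s \<notin> interior_pts M Y"
    by (auto simp: image_subset_iff)
  define e where "e = \<gamma> s"
  have e: "e \<in> bdry M Y" "e \<in> Y"
    using \<open>\<gamma> s \<notin> interior_pts M Y\<close> shortest_path_in[OF \<gamma>] s
    by (auto simp: interior_pts_def e_def)
  have \<alpha>\<beta>: "\<alpha> \<in> Y" "\<beta> \<in> Y" "\<alpha> \<noteq> \<beta>" "\<gamma> 0 = \<alpha>" "\<gamma> 1 = \<beta>"
    using \<gamma> by (auto simp: shortest_path_def)
  have e_dist: "rho M Y \<alpha> e = s * rho M Y \<alpha> \<beta>" "rho M Y e \<beta> = (1 - s) * rho M Y \<alpha> \<beta>"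
    using shortest_path_dist[OF metric \<gamma>, of 0 s] shortest_path_dist[OF metric \<gamma>, of s 1] s \<alpha>\<beta>
    by (auto simp: e_def)
  have e_pos: "0 < rho M Y \<alpha> e" "0 < rho M Y e \<beta>"
    unfolding e_dist using s \<alpha>\<beta> mdist_pos_less by auto
  have e_sum: "rho M Y \<alpha> e + rho M Y e \<beta> = rho M Y \<alpha> \<beta>"
    unfolding e_dist by (simp add: algebra_simps)
  obtain c d \<delta> where cd: "c \<in> bdry M Y" "d \<in> bdry M Y" and \<delta>: "shortest_path M Y c d \<delta>"
    and "\<alpha> \<in> \<delta> ` {0..1}" "\<beta> \<in> \<delta> ` {0..1}"
    using iii \<alpha>\<beta>(1,2) unfolding cond_iii_def by blast
  then obtain u v where uv: "0 \<le> u" "u \<le> 1" "0 \<le> v" "v \<le> 1" "\<alpha> = \<delta> u" "\<beta> = \<delta> v"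
    by auto
  have in_Y: "c \<in> Y" "d \<in> Y" using cd by (auto simp: bdry_def)
  note witness = that
  have result: thesis
    if p: "0 \<le> p" "p < q" "q \<le> 1"
      and pos: "0 < rho M Y (\<delta> p) e" "0 < rho M Y e (\<delta> q)"
      and sum: "rho M Y (\<delta> p) e + rho M Y e (\<delta> q) = rho M Y (\<delta> p) (\<delta> q)" for p q
  proof -
    have \<delta>_in: "\<delta> p \<in> Y" "\<delta> q \<in> Y"
      using shortest_path_in[OF \<delta>] p by auto
    have \<delta>_dist: "rho M Y c (\<delta> p) = p * rho M Y c d"
        "rho M Y (\<delta> q) d = (1 - q) * rho M Y c d"
        "rho M Y (\<delta> p) (\<delta> q) = (q - p) * rho M Y c d"
      using shortest_path_dist[OF metric \<delta>, of 0 p] shortest_path_dist[OF metric \<delta>, of q 1]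
        shortest_path_dist[OF metric \<delta>, of p q] p \<delta> by (auto simp: shortest_path_def)
    have total: "rho M Y c (\<delta> p) + rho M Y (\<delta> p) e + rho M Y e (\<delta> q) + rho M Y (\<delta> q) d
        = rho M Y c d"
      using sum unfolding \<delta>_dist by (simp add: algebra_simps)
    have ce: "rho M Y c e \<le> rho M Y c (\<delta> p) + rho M Y (\<delta> p) e"
      and ed: "rho M Y e d \<le> rho M Y e (\<delta> q) + rho M Y (\<delta> q) d"
      and cd_le: "rho M Y c d \<le> rho M Y c e + rho M Y e d"
      using triangle in_Y e \<delta>_in by auto
    (* If e were an end point, the whole distance from c to d would be covered by one of the two
       parts of the path, although the other has positive length. *)
    have "c \<noteq> e"
    proof
      assume "c = e"
      then show False
        using ed total pos nonneg[of c "\<delta> p"] unfolding \<open>c = e\<close> by linarith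
    qed
    moreover have "e \<noteq> d"
    proof
      assume "e = d"
      then show False
        using ce total pos nonneg[of "\<delta> q" d] unfolding \<open>e = d\<close> by linarith
    qed
    moreover have "rho M Y c e + rho M Y e d = rho M Y c d"
      using ce ed cd_le total by simp
    ultimately show thesis using witness cd e(1) by blast
  qed
  (* The path from c to d may pass through beta first; by symmetry the roles are exchanged. *)
  consider "u < v" | "v < u" using uv \<alpha>\<beta> by fastforce
  then show thesis
  proof cases
    case 1 then show thesis using result[of u v] uv e_pos e_sum by simp
  next
    case 2 then show thesis using result[of v u] uv e_pos e_sum by (simp add: commute)
  qed
qed

section \<open>Isometric boundaries\<close>

text \<open>
  An isometry of the boundaries would carry a boundary point strictly between two others back from
  \<open>Y\<^sub>2\<close> to \<open>Y\<^sub>1\<close>.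
\<close>

lemma strictly_convex_transfer:
  assumes "Metric_space Y\<^sub>1 (rho M Y\<^sub>1)" "cond_iii M Y\<^sub>1" "strictly_convex M Y\<^sub>1"
    and "Metric_space Y\<^sub>2 (rho M Y\<^sub>2)" "cond_iii M Y\<^sub>2"
    and f: "f ` bdry M Y\<^sub>1 = bdry M Y\<^sub>2"
      "\<And>x y. x \<in> bdry M Y\<^sub>1 \<Longrightarrow> y \<in> bdry M Y\<^sub>1 \<Longrightarrow> rho M Y\<^sub>2 (f x) (f y) = rho M Y\<^sub>1 x y"
  shows "strictly_convex M Y\<^sub>2"
proof (rule ccontr)
  assume "\<not> strictly_convex M Y\<^sub>2"
  then obtain c d e where "c \<in> bdry M Y\<^sub>2" "d \<in> bdry M Y\<^sub>2" "e \<in> bdry M Y\<^sub>2" "c \<noteq> e" "e \<noteq> d"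
    and between: "rho M Y\<^sub>2 c e + rho M Y\<^sub>2 e d = rho M Y\<^sub>2 c d"
    using boundary_betweenness_if_not_strictly_convex[OF assms(4,5)] by blast
  then obtain c' d' e' where pre: "c' \<in> bdry M Y\<^sub>1" "d' \<in> bdry M Y\<^sub>1" "e' \<in> bdry M Y\<^sub>1"
    "c = f c'" "d = f d'" "e = f e'"
    unfolding f(1)[symmetric] by blast
  then have "rho M Y\<^sub>1 c' e' + rho M Y\<^sub>1 e' d' = rho M Y\<^sub>1 c' d'"
    using between f(2) by simp
  moreover have "c' \<noteq> e'" "e' \<noteq> d'" "c' \<in> Y\<^sub>1" "d' \<in> Y\<^sub>1"
    using pre \<open>c \<noteq> e\<close> \<open>e \<noteq> d\<close> by (auto simp: bdry_def)
  ultimately show False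
    using no_boundary_betweenness_if_strictly_convex[OF assms(1-3)] pre(3) by blast
qed

theorem theorem3p5:
  fixes M :: "('a, 'n::finite) riemannian" and Y\<^sub>1 Y\<^sub>2 :: "'a set"
  assumes "CARD('n) \<ge> 3"
    and "riemannian_manifold M" and "connected_space (rtop M)"
    and "admissible M Y\<^sub>1" and "admissible M Y\<^sub>2"
    and "strictly_convex M Y\<^sub>1"
    and "\<And>Y x y. \<lbrakk>admissible M Y; strictly_convex M Y; x \<in> Y; y \<in> Y\<rbrakk> \<Longrightarrow> rho_X M x y = rho M Y x y"
    and "isometric_sets (bdry M Y\<^sub>1) (rho M Y\<^sub>1) (bdry M Y\<^sub>2) (rho M Y\<^sub>2)"
  shows "isometric_sets (bdry M Y\<^sub>1) (rho_X M) (bdry M Y\<^sub>2) (rho_X M)"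
proof -
  obtain f where f: "f ` bdry M Y\<^sub>1 = bdry M Y\<^sub>2"
    "\<And>x y. x \<in> bdry M Y\<^sub>1 \<Longrightarrow> y \<in> bdry M Y\<^sub>1 \<Longrightarrow> rho M Y\<^sub>2 (f x) (f y) = rho M Y\<^sub>1 x y"
    using assms(8) unfolding isometric_sets_def by blast
  have convex\<^sub>2: "strictly_convex M Y\<^sub>2"
    using strictly_convex_transfer[OF _ _ assms(6) _ _ f] assms(4,5)
    by (simp add: admissible_def cond_ii_def)
  have "rho_X M (f x) (f y) = rho_X M x y" if "x \<in> bdry M Y\<^sub>1" "y \<in> bdry M Y\<^sub>1" for x y
  proof -
    have "x \<in> Y\<^sub>1" "y \<in> Y\<^sub>1" using that by (auto simp: bdry_def)
    moreover have "f x \<in> bdry M Y\<^sub>2" "f y \<in> bdry M Y\<^sub>2" using f(1) that by blast+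
    then have "f x \<in> Y\<^sub>2" "f y \<in> Y\<^sub>2" by (auto simp: bdry_def)
    ultimately show ?thesis
      using assms(7)[OF assms(4,6)] assms(7)[OF assms(5) convex\<^sub>2] f(2)[OF that] by simp
  qed
  then show ?thesis
    using f(1) unfolding isometric_sets_def by blast
qed

end
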